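(* For every $\epsilon > 0$ there exists a Radon probability measure $\mu$ on $\mathbb{R}^2$ supported on $[0,1]^2$ with the following properties: (i) for all $x \in \operatorname{spt}\mu$, $$\sum_{Q \in \mathcal{D}} \beta_{2,\mu}(3Q)^2\, \frac{\ell(Q)}{\mu(Q)}\, 1_Q(x) \leq \epsilon;$$ (ii) if $\Gamma \subset \mathbb{R}^2$ is any $\mathcal{H}^1$-measurable set with $\mathcal{H}^1(\Gamma) \leq 1$, then $\mu(\Gamma) \leq \epsilon$.
   Context: $\mathcal{D}$ is the standard dyadic grid in $\mathbb{R}^2$: all half-open squares $[k2^{-j},(k+1)2^{-j}) \times [l2^{-j},(l+1)2^{-j})$ with $j,k,l \in \mathbb{Z}$ (all side-lengths are included in the sum). $\ell(Q)$ is the side-length of $Q$, and $3Q$ is the square with the same centre as $Q$ dilated by a factor of three, i.e. the union of $Q$ with its eight dyadic neighbours of the same side-length. $\operatorname{spt}\mu$ is the (closed) support of $\mu$, and $\mathcal{H}^1$ is $1$-dimensional Hausdorff measure. For a Radon measure $\mu$ on $\mathbb{R}^2$ and a square $Q \subset \mathbb{R}^2$ with $\mu(Q) > 0$, $$\beta_{2,\mu}(Q) = \inf_L \left[ \frac{1}{\mu(Q)} \int_Q \left( \frac{d(y,L)}{\operatorname{diam}(Q)} \right)^2 d\mu(y) \right]^{1/2},$$ where the infimum is over all affine lines $L \subset \mathbb{R}^2$ and $d(y,L)$ is the Euclidean distance from $y$ to $L$. *)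

theory Defs
  imports "HOL-Probability.Probability"
begin

text \<open>The plane is \<^typ>\<open>real \<times> real\<close>, whose \<^const>\<open>dist\<close> is the Euclidean distance.\<close>

definition dyadic_len :: "int \<Rightarrow> real" where
  "dyadic_len j = 2 powi (- j)"

definition dyadic_square :: "int \<Rightarrow> int \<Rightarrow> int \<Rightarrow> (real \<times> real) set" where
  "dyadic_square j k l =
     {of_int k * dyadic_len j ..< (of_int k + 1) * dyadic_len j} \<times>
     {of_int l * dyadic_len j ..< (of_int l + 1) * dyadic_len j}"

text \<open>The dilate \<open>3Q\<close>, as the half-open union of \<open>Q\<close> and its eight neighbours.\<close>

definition dyadic_triple :: "int \<Rightarrow> int \<Rightarrow> int \<Rightarrow> (real \<times> real) set" where
  "dyadic_triple j k l =
     {(of_int k - 1) * dyadic_len j ..< (of_int k + 2) * dyadic_len j} \<times>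
     {(of_int l - 1) * dyadic_len j ..< (of_int l + 2) * dyadic_len j}"

text \<open>Distinct indices give distinct squares, so a sum over all \<open>(j, k, l)\<close> is the same as a
  sum over the set of all dyadic squares.\<close>

lemma inj_dyadic_square: "inj (\<lambda>(j, k, l). dyadic_square j k l)"
proof (rule injI, clarsimp)
  fix j k l j' k' l' :: int
  assume eq: "dyadic_square j k l = dyadic_square j' k' l'"
  have pos: "dyadic_len i > 0" for i
    by (simp add: dyadic_len_def)
  have ne: "of_int m * dyadic_len i < (of_int m + 1) * dyadic_len i" for m i :: int
    using pos[of i] by (simp add: algebra_simps)
  have ne': "{of_int m * dyadic_len i ..< (of_int m + 1) * dyadic_len i} \<noteq> {}" for m i :: int
    using ne[of m i] by auto
  from eq have
    "{of_int k * dyadic_len j ..< (of_int k + 1) * dyadic_len j} =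
     {of_int k' * dyadic_len j' ..< (of_int k' + 1) * dyadic_len j'}"
    "{of_int l * dyadic_len j ..< (of_int l + 1) * dyadic_len j} =
     {of_int l' * dyadic_len j' ..< (of_int l' + 1) * dyadic_len j'}"
    unfolding dyadic_square_def times_eq_iff using ne' by blast+
  then have e: "of_int k * dyadic_len j = of_int k' * dyadic_len j'"
    "(of_int k + 1) * dyadic_len j = (of_int k' + 1) * dyadic_len j'"
    "of_int l * dyadic_len j = of_int l' * dyadic_len j'"
    using ne by (simp_all only: atLeastLessThan_eq_iff)
  then have len: "dyadic_len j = dyadic_len j'"
    by (simp add: algebra_simps)
  then have "- j = - j'"
    unfolding dyadic_len_def
    using power_int_strict_increasing[of "- j" "- j'" "2::real"]
      power_int_strict_increasing[of "- j'" "- j" "2::real"]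
    by (cases "- j" "- j'" rule: linorder_cases) auto
  then show "j = j' \<and> k = k' \<and> l = l'"
    using e len pos[of j'] by auto
qed

definition radon_measure :: "'a::topological_space measure \<Rightarrow> bool" where
  "radon_measure \<mu> \<longleftrightarrow>
     sets \<mu> = sets borel \<and>
     (\<forall>K. compact K \<longrightarrow> emeasure \<mu> K < \<infinity>) \<and>
     (\<forall>U. open U \<longrightarrow> emeasure \<mu> U = (SUP K\<in>{K. K \<subseteq> U \<and> compact K}. emeasure \<mu> K)) \<and>
     (\<forall>B\<in>sets borel. emeasure \<mu> B = (INF U\<in>{U. B \<subseteq> U \<and> open U}. emeasure \<mu> U))"

definition spt :: "'a::topological_space measure \<Rightarrow> 'a set" where
  "spt \<mu> = {x. \<forall>U. open U \<longrightarrow> x \<in> U \<longrightarrow> emeasure \<mu> U > 0}"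

text \<open>Only meaningful for \<open>Q\<close> bounded with positive measure; the value for a null set \<open>Q\<close> is
  \<open>0\<close> because of division by zero in \<^typ>\<open>real\<close>.\<close>

definition beta2 :: "(real \<times> real) measure \<Rightarrow> (real \<times> real) set \<Rightarrow> real" where
  "beta2 \<mu> Q =
     (INF L\<in>{L. affine L \<and> aff_dim L = 1}.
        sqrt (1 / measure \<mu> Q * (LINT y:Q|\<mu>. (infdist y L / diameter Q)\<^sup>2)))"

text \<open>A point \<open>x\<close> of the support may lie on the boundary of a half-open \<open>Q\<close> with
  \<open>\<mu>(Q) = 0\<close>.  In \<^typ>\<open>ennreal\<close> such a term is \<open>\<infinity>\<close> unless \<open>\<beta>(3Q) = 0\<close>.  On the other
  hand \<open>\<mu>(3Q) > 0\<close> whenever \<open>Q\<close> meets the support, since \<open>Q\<close> lies in the interior of \<open>3Q\<close>.\<close>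

definition density_jones :: "(real \<times> real) measure \<Rightarrow> real \<times> real \<Rightarrow> ennreal" where
  "density_jones \<mu> x =
     (\<Sum>\<^sub>\<infinity>(j, k, l)\<in>UNIV.
        ennreal ((beta2 \<mu> (dyadic_triple j k l))\<^sup>2) *
        (ennreal (dyadic_len j) / emeasure \<mu> (dyadic_square j k l)) *
        indicator (dyadic_square j k l) x)"

text \<open>One-dimensional Hausdorff (outer) measure.  Boundedness of the covering sets is required
  explicitly because \<^const>\<open>diameter\<close> is unspecified on unbounded sets.\<close>

definition hausdorff1_pre :: "real \<Rightarrow> 'a::metric_space set \<Rightarrow> ennreal" where
  "hausdorff1_pre \<delta> A =
     (INF C\<in>{C :: nat \<Rightarrow> 'a set. A \<subseteq> (\<Union>i. C i) \<and> (\<forall>i. bounded (C i) \<and> diameter (C i) \<le> \<delta>)}.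
        \<Sum>i. ennreal (diameter (C i)))"

definition hausdorff1 :: "'a::metric_space set \<Rightarrow> ennreal" where
  "hausdorff1 A = (SUP \<delta>\<in>{0<..}. hausdorff1_pre \<delta> A)"

text \<open>Caratheodory measurability with respect to the outer measure \<^const>\<open>hausdorff1\<close>.
  A measurable \<open>\<Gamma>\<close> need not be Borel, so \<open>\<mu>(\<Gamma>)\<close> is read as \<^term>\<open>outer_measure_of \<mu> \<Gamma>\<close>,
  which agrees with \<open>\<mu>\<close> on Borel sets.\<close>

definition hausdorff1_measurable :: "'a::metric_space set \<Rightarrow> bool" where
  "hausdorff1_measurable A \<longleftrightarrow> A \<in> lambda_system UNIV UNIV hausdorff1"

end

theory Submission
  imports Defs
begin

text \<open>
  Since the Jones function is normalised by \<open>\<mu>(3Q)\<close> inside \<open>\<beta>\<close>, a light piece of \<open>\<mu>\<close> close to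
  a heavy line is cheap, however low its density.  Put mass \<open>h\<close> on a horizontal segment of length
  \<open>\<eta> / 3\<close> at height \<open>0\<close>, and mass \<open>w = (1 - h) / N\<close> on each of \<open>N\<close> translates of it at the
  heights \<open>\<eta> * 4 ^ (- i)\<close>.  At a scale below \<open>\<eta>\<close>, a square touching the heavy segment has
  \<open>\<beta>\<^sup>2 \<le> 2 * w / h\<close> and \<open>\<ell>(Q) / \<mu>(Q) \<le> \<eta> / h\<close>; there are about \<open>2 * N\<close> such scales before
  only the heavy segment is visible.  A light segment leaves the heavy one at a single scale, with
  \<open>\<beta>\<^sup>2 \<le> 2 * w / h\<close> and \<open>\<ell>(Q) / \<mu>(Q) \<le> \<eta> / w\<close>, and is isolated below it, where \<open>\<beta> = 0\<close>.
  Hence the Jones function is of order \<open>\<eta> / h\<^sup>2\<close>, uniformly in \<open>N\<close>.  On the other hand the light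
  segments have linear density \<open>3 * w / \<eta>\<close>, which tends to \<open>0\<close> as \<open>N\<close> grows, so a set of length
  \<open>1\<close> catches little more than the mass \<open>h\<close>.
\<close>

section \<open>Dyadic lengths and sums over dyadic scales\<close>

lemma dyadic_len_pos [simp]: "dyadic_len j > 0"
  by (simp add: dyadic_len_def)

lemma dyadic_len_neq_0 [simp]: "dyadic_len j \<noteq> 0"
  using dyadic_len_pos[of j] by linarith

lemma dyadic_len_less_iff [simp]: "dyadic_len i < dyadic_len j \<longleftrightarrow> j < i"
proof -
  have mono: "dyadic_len a < dyadic_len b" if "b < a" for a b
    unfolding dyadic_len_def using that by (intro power_int_strict_increasing) auto
  show ?thesis
    using mono[of i j] mono[of j i] by (cases i j rule: linorder_cases) auto
qed

lemma dyadic_len_le_iff [simp]: "dyadic_len i \<le> dyadic_len j \<longleftrightarrow> j \<le> i"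
  by (simp flip: not_less)

lemma dyadic_len_diff_nat: "dyadic_len (j - int e) = 2 ^ e * dyadic_len j"
  by (simp add: dyadic_len_def power_int_diff power_int_minus field_simps)

lemma dyadic_interval_unique:
  fixes k k' :: int
  assumes "t \<in> {of_int k * dyadic_len j ..< (of_int k + 1) * dyadic_len j}"
    and "t \<in> {of_int k' * dyadic_len j ..< (of_int k' + 1) * dyadic_len j}"
  shows "k = k'"
proof -
  have "\<lfloor>t / dyadic_len j\<rfloor> = i"
    if "t \<in> {of_int i * dyadic_len j ..< (of_int i + 1) * dyadic_len j}" for i
    using that by (simp add: floor_eq_iff field_simps)
  then show ?thesis using assms by metis
qed

lemma sum_half_powers_le:
  fixes e :: "'a \<Rightarrow> nat"
  assumes "finite F" "inj_on e F"
  shows "(\<Sum>i\<in>F. (1/2::real) ^ e i) \<le> 2"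
proof -
  have "(\<Sum>i\<in>F. (1/2::real) ^ e i) = (\<Sum>n\<in>e ` F. (1/2) ^ n)"
    using assms by (simp add: sum.reindex)
  also have "\<dots> \<le> (\<Sum>n. (1/2::real) ^ n)"
    using assms by (intro sum_le_suminf) (auto simp: summable_geometric)
  also have "\<dots> = 2"
    by (subst suminf_geometric) auto
  finally show ?thesis .
qed

text \<open>At each scale at most one dyadic square contains \<open>x\<close>, so the sum over
  squares collapses to a sum over scales \<open>j\<close>. Finite partial sums suffice because a sum
  in \<open>ennreal\<close> is their supremum.\<close>

lemma density_jones_le:
  assumes le: "\<And>j k l. x \<in> dyadic_square j k l \<Longrightarrow>
      ennreal ((beta2 \<mu> (dyadic_triple j k l))\<^sup>2) *
        (ennreal (dyadic_len j) / emeasure \<mu> (dyadic_square j k l)) \<le> ennreal (g j)"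
    and g: "\<And>j. 0 \<le> g j"
    and sum: "\<And>F. finite F \<Longrightarrow> sum g F \<le> B"
  shows "density_jones \<mu> x \<le> ennreal B"
  unfolding density_jones_def
proof (subst nonneg_infsum_complete, simp, rule SUP_least, clarsimp)
  fix F :: "(int \<times> int \<times> int) set"
  assume "finite F"
  define F' where "F' = {(j, k, l) \<in> F. x \<in> dyadic_square j k l}"
  have fin: "finite F'"
    using \<open>finite F\<close> by (rule rev_finite_subset) (auto simp: F'_def)
  have inj: "inj_on fst F'"
  proof (rule inj_onI)
    fix p q
    assume "p \<in> F'" "q \<in> F'" "fst p = fst q"
    then show "p = q"
      using dyadic_interval_unique[of "fst x" "fst (snd p)" "fst p" "fst (snd q)"]
        dyadic_interval_unique[of "snd x" "snd (snd p)" "fst p" "snd (snd q)"]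
      by (cases p; cases q) (auto simp: F'_def dyadic_square_def)
  qed
  let ?f = "\<lambda>(j, k, l). ennreal ((beta2 \<mu> (dyadic_triple j k l))\<^sup>2) *
        (ennreal (dyadic_len j) / emeasure \<mu> (dyadic_square j k l)) *
        indicator (dyadic_square j k l) x"
  have "sum ?f F = sum ?f F'"
    using \<open>finite F\<close>
    by (intro sum.mono_neutral_right) (auto simp: F'_def indicator_def split: if_splits)
  also have "\<dots> \<le> (\<Sum>p\<in>F'. ennreal (g (fst p)))"
    by (intro sum_mono) (auto simp: F'_def le)
  also have "\<dots> = (\<Sum>j\<in>fst ` F'. ennreal (g j))"
    using inj by (simp add: sum.reindex)
  also have "\<dots> = ennreal (sum g (fst ` F'))"
    using g by (intro sum_ennreal) auto
  also have "\<dots> \<le> ennreal B"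
    using fin sum by (intro ennreal_leI) auto
  finally show "sum ?f F \<le> ennreal B" .
qed

section \<open>Radon property and support\<close>

lemma finite_borel_measure_radon:
  fixes \<mu> :: "'a::{second_countable_topology, complete_space} measure"
  assumes "finite_measure \<mu>" "sets \<mu> = sets borel"
  shows "radon_measure \<mu>"
proof -
  have fin: "emeasure \<mu> (space \<mu>) \<noteq> \<infinity>"
    using assms(1) by (simp add: finite_measure.emeasure_finite)
  show ?thesis
    unfolding radon_measure_def
    using assms inner_regular[OF assms(2) fin] outer_regular[OF assms(2) fin]
    by (auto simp: finite_measure.emeasure_finite less_top[symmetric])
qed

lemma spt_subset_closed:
  assumes "closed K" "sets \<mu> = sets borel" "emeasure \<mu> (- K) = 0"
  shows "spt \<mu> \<subseteq> K"
  using assms by (fastforce simp: spt_def)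

section \<open>Beta numbers of product measures\<close>

lemma infdist_horizontal_line:
  fixes z :: "real \<times> real"
  shows "infdist z {z. snd z = c} = \<bar>snd z - c\<bar>"
proof (rule antisym)
  have "infdist z {z. snd z = c} \<le> dist z (fst z, c)"
    by (rule infdist_le) auto
  also have "\<dots> = \<bar>snd z - c\<bar>"
    by (cases z) (simp add: dist_prod_def dist_real_def)
  finally show "infdist z {z. snd z = c} \<le> \<bar>snd z - c\<bar>" .
  have "{z :: real \<times> real. snd z = c} \<noteq> {}"
    by (auto intro: exI[of _ "(0, c)"])
  then show "\<bar>snd z - c\<bar> \<le> infdist z {z. snd z = c}"
    unfolding infdist_def
    using dist_snd_le[of z] by (auto intro!: cINF_greatest simp flip: dist_real_def)
qed

lemma horizontal_line_affine:
  "affine {z :: real \<times> real. snd z = c} \<and> aff_dim {z :: real \<times> real. snd z = c} = 1"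
proof -
  have "{z :: real \<times> real. snd z = c} = {z. (0, 1) \<bullet> z = c}"
    by (auto simp: inner_prod_def)
  then show ?thesis
    using affine_hyperplane[of "(0::real, 1::real)" c] aff_dim_hyperplane[of "(0::real, 1::real)" c]
    by (simp add: zero_prod_def)
qed

text \<open>The infimum is tested with the horizontal line at height \<open>c\<close>. The distance
  to it depends on the second coordinate only, so Fubini splits off a factor
  \<open>measure \<nu> A\<close>, which the normalisation cancels.\<close>

lemma beta2_pair_measure_le:
  fixes \<nu> \<sigma> :: "real measure"
  assumes "prob_space \<nu>" "prob_space \<sigma>"
    and [measurable_cong]: "sets \<nu> = sets borel" "sets \<sigma> = sets borel"
    and [measurable]: "A \<in> sets borel" "B \<in> sets borel"
  shows "(beta2 (\<nu> \<Otimes>\<^sub>M \<sigma>) (A \<times> B))\<^sup>2 \<le>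
    (LINT t:B|\<sigma>. (t - c)\<^sup>2) / ((diameter (A \<times> B))\<^sup>2 * measure \<sigma> B)"
proof -
  interpret N: prob_space \<nu> by fact
  interpret S: prob_space \<sigma> by fact
  interpret pair_prob_space \<nu> \<sigma> ..
  define D where "D = diameter (A \<times> B)"
  define T where "T = (LINT t:B|\<sigma>. (t - c)\<^sup>2)"
  have T0: "0 \<le> T"
    unfolding T_def set_lebesgue_integral_def by (rule Bochner_Integration.integral_nonneg) auto
  have m: "measure (\<nu> \<Otimes>\<^sub>M \<sigma>) (A \<times> B) = measure \<nu> A * measure \<sigma> B"
    by (simp add: measure_def S.emeasure_pair_measure_Times enn2real_mult)
  let ?L = "{z :: real \<times> real. snd z = c}"
  let ?f = "\<lambda>z. indicator (A \<times> B) z *\<^sub>R (infdist z ?L / D)\<^sup>2"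
  have int: "(LINT z:A \<times> B|\<nu> \<Otimes>\<^sub>M \<sigma>. (infdist z ?L / D)\<^sup>2) \<le> measure \<nu> A * T / D\<^sup>2"
  proof (cases "integrable (\<nu> \<Otimes>\<^sub>M \<sigma>) ?f")
    case True
    have "(LINT z:A \<times> B|\<nu> \<Otimes>\<^sub>M \<sigma>. (infdist z ?L / D)\<^sup>2) = (\<integral>x. \<integral>t. ?f (x, t) \<partial>\<sigma> \<partial>\<nu>)"
      unfolding set_lebesgue_integral_def by (rule integral_fst'[OF True, symmetric])
    also have "\<dots> = (\<integral>x. indicator A x * (T / D\<^sup>2) \<partial>\<nu>)"
    proof (rule Bochner_Integration.integral_cong[OF refl])
      fix x
      have "(\<integral>t. ?f (x, t) \<partial>\<sigma>) = (\<integral>t. (indicator A x / D\<^sup>2) * (indicator B t *\<^sub>R (t - c)\<^sup>2) \<partial>\<sigma>)"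
        by (intro Bochner_Integration.integral_cong)
           (auto simp: infdist_horizontal_line indicator_def power_divide)
      also have "\<dots> = indicator A x * (T / D\<^sup>2)"
        unfolding T_def set_lebesgue_integral_def by (subst integral_mult_right_zero) simp
      finally show "(\<integral>t. ?f (x, t) \<partial>\<sigma>) = indicator A x * (T / D\<^sup>2)" .
    qed
    also have "\<dots> = measure \<nu> A * T / D\<^sup>2"
      by simp
    finally show ?thesis by simp
  next
    \<comment> \<open>A Bochner integral that does not exist is \<open>0\<close> by convention,
      hence below the bound.\<close>
    case False
    then show ?thesis
      using T0 by (simp add: set_lebesgue_integral_def not_integrable_integral_eq)
  qed
  let ?v = "1 / measure (\<nu> \<Otimes>\<^sub>M \<sigma>) (A \<times> B) * (LINT z:A \<times> B|\<nu> \<Otimes>\<^sub>M \<sigma>. (infdist z ?L / D)\<^sup>2)"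
  let ?r = "\<lambda>L. sqrt (1 / measure (\<nu> \<Otimes>\<^sub>M \<sigma>) (A \<times> B) *
      (LINT z:A \<times> B|\<nu> \<Otimes>\<^sub>M \<sigma>. (infdist z L / D)\<^sup>2))"
  have nn: "0 \<le> ?r L" for L :: "(real \<times> real) set"
    unfolding set_lebesgue_integral_def
    by (intro real_sqrt_ge_zero mult_nonneg_nonneg Bochner_Integration.integral_nonneg) auto
  have "beta2 (\<nu> \<Otimes>\<^sub>M \<sigma>) (A \<times> B) \<le> ?r ?L"
    unfolding beta2_def D_def[symmetric]
    by (rule cINF_lower[OF bdd_belowI2[of _ 0]]) (use nn horizontal_line_affine in auto)
  moreover have "0 \<le> beta2 (\<nu> \<Otimes>\<^sub>M \<sigma>) (A \<times> B)"
    unfolding beta2_def D_def[symmetric]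
    by (rule cINF_greatest) (use nn horizontal_line_affine[of c] in auto)
  ultimately have "(beta2 (\<nu> \<Otimes>\<^sub>M \<sigma>) (A \<times> B))\<^sup>2 \<le> (?r ?L)\<^sup>2"
    by (rule power_mono)
  also have "\<dots> = ?v"
    using nn[of ?L] by (subst real_sqrt_pow2) simp_all
  also have "\<dots> \<le> 1 / measure (\<nu> \<Otimes>\<^sub>M \<sigma>) (A \<times> B) * (measure \<nu> A * T / D\<^sup>2)"
    using int by (rule mult_left_mono) simp
  \<comment> \<open>If \<open>measure \<nu> A = 0\<close>, the left side is \<open>0\<close> by
    division by zero; otherwise this factor cancels.\<close>
  also have "\<dots> \<le> T / (D\<^sup>2 * measure \<sigma> B)"
    using T0 by (cases "measure \<nu> A = 0") (auto simp: m field_simps)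
  finally show ?thesis
    unfolding T_def D_def .
qed

text \<open>Two points of the triple at distance one side-length are enough; the exact diameter is
  larger by a constant factor only.\<close>

lemma diameter_dyadic_triple_ge: "dyadic_len j \<le> diameter (dyadic_triple j k l)"
proof -
  have "bounded (dyadic_triple j k l)"
    unfolding dyadic_triple_def by (intro bounded_Times) auto
  moreover have "((of_int k - 1) * dyadic_len j, of_int l * dyadic_len j) \<in> dyadic_triple j k l"
    "(of_int k * dyadic_len j, of_int l * dyadic_len j) \<in> dyadic_triple j k l"
    by (auto simp: dyadic_triple_def)
  ultimately have "dist ((of_int k - 1) * dyadic_len j, of_int l * dyadic_len j)
      (of_int k * dyadic_len j, of_int l * dyadic_len j) \<le> diameter (dyadic_triple j k l)"
    by (rule diameter_bounded_bound)
  then show ?thesis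
    by (simp add: dist_prod_def dist_real_def algebra_simps)
qed

text \<open>The bound \<open>q\<close> makes the mass of \<open>Q\<close> positive and finiteness of
  \<open>\<mu>\<close> makes it finite, so the quotient in \<open>ennreal\<close> agrees with the
  real one.\<close>

lemma jones_term_le:
  assumes "finite_measure \<mu>" "(beta2 \<mu> P)\<^sup>2 \<le> v" "0 < q" "q \<le> measure \<mu> Q" "0 \<le> r"
  shows "ennreal ((beta2 \<mu> P)\<^sup>2) * (ennreal r / emeasure \<mu> Q) \<le> ennreal (v * r / q)"
proof -
  have "emeasure \<mu> Q = ennreal (measure \<mu> Q)"
    using assms(1) by (rule finite_measure.emeasure_eq_measure)
  then have "ennreal ((beta2 \<mu> P)\<^sup>2) * (ennreal r / emeasure \<mu> Q)
      = ennreal ((beta2 \<mu> P)\<^sup>2 * (r / measure \<mu> Q))"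
    using assms by (simp add: divide_ennreal flip: ennreal_mult)
  also have "(beta2 \<mu> P)\<^sup>2 * (r / measure \<mu> Q) \<le> v * (r / q)"
    using assms order_trans[OF zero_le_power2 assms(2)]
    by (intro mult_mono divide_left_mono mult_pos_pos) auto
  finally show ?thesis
    by (simp add: ennreal_leI)
qed

section \<open>The measure: one heavy and \<open>N\<close> light horizontal segments\<close>

locale light_lines =
  fixes m N :: nat and h :: real
  assumes h: "0 < h" "h < 1" and N: "0 < N"
begin

definition \<eta> :: real where "\<eta> = dyadic_len (int m)"

definition w :: real where "w = (1 - h) / real N"

text \<open>Index \<open>0\<close> is the heavy line. Consecutive light heights have ratio 4 rather
  than 2, so that the range from \<open>t / 2\<close> to \<open>2 * t\<close> around a light height
  \<open>t\<close> contains no other one.\<close>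

definition height :: "nat \<Rightarrow> real" where
  "height i = (if i = 0 then 0 else dyadic_len (int m + 2 * int i))"

definition wt :: "nat \<Rightarrow> real" where "wt i = (if i = 0 then h else w)"

text \<open>The middle third has non-dyadic end points, so a small dyadic interval that meets it,
  even at an end point, meets it in a fixed proportion of its length.\<close>

definition \<nu> :: "real measure" where "\<nu> = uniform_measure lborel {\<eta> / 3..2 * \<eta> / 3}"

definition \<sigma> :: "real measure" where
  "\<sigma> = distr (point_measure {..N} (\<lambda>i. ennreal (wt i))) borel height"

definition \<mu> :: "(real \<times> real) measure" where "\<mu> = \<nu> \<Otimes>\<^sub>M \<sigma>"

lemma \<eta>_pos: "0 < \<eta>"
  by (simp add: \<eta>_def)

lemma w_pos: "0 < w"
  using h N by (simp add: w_def)

lemma wt_nonneg: "0 \<le> wt i"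
  using h w_pos by (simp add: wt_def)

lemma height_nonneg: "0 \<le> height i"
  by (simp add: height_def less_imp_le)

lemma height_less: "height i < \<eta>"
  by (simp add: height_def \<eta>_def)

lemma sum_wt: "sum wt {..N} = 1"
proof -
  have "{..N} = insert 0 {1..N}" by auto
  then have "sum wt {..N} = h + (\<Sum>i=1..N. w)"
    by (auto simp: wt_def)
  then show ?thesis
    using N by (simp add: w_def)
qed

lemma sets_\<nu> [measurable_cong, simp]: "sets \<nu> = sets borel"
  by (simp add: \<nu>_def)

lemma sets_\<sigma> [measurable_cong, simp]: "sets \<sigma> = sets borel"
  by (simp add: \<sigma>_def)

lemma sets_\<mu> [simp]: "sets \<mu> = sets borel"
  unfolding \<mu>_def by (subst borel_prod[symmetric]) (rule sets_pair_measure_cong; simp)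

lemma measure_\<nu>:
  assumes "A \<in> sets borel"
  shows "measure \<nu> A = measure lborel ({\<eta> / 3..2 * \<eta> / 3} \<inter> A) * 3 / \<eta>"
  using assms \<eta>_pos unfolding \<nu>_def by (subst measure_uniform_measure) auto

lemma measure_\<sigma>:
  assumes "B \<in> sets borel"
  shows "measure \<sigma> B = (\<Sum>i | i \<le> N \<and> height i \<in> B. wt i)"
proof -
  have "measure \<sigma> B = measure (point_measure {..N} (\<lambda>i. ennreal (wt i))) {i. i \<le> N \<and> height i \<in> B}"
    unfolding \<sigma>_def using assms
    by (subst measure_distr) (auto intro!: arg_cong2[where f = measure] simp: space_point_measure)
  also have "\<dots> = (\<Sum>i | i \<le> N \<and> height i \<in> B. wt i)"
    using wt_nonneg
    by (subst measure_def, subst emeasure_point_measure_finite) (auto simp: sum_nonneg)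
  finally show ?thesis .
qed

lemma integral_\<sigma>:
  assumes "B \<in> sets borel" and [measurable]: "f \<in> borel_measurable borel"
  shows "(LINT t:B|\<sigma>. f t) = (\<Sum>i | i \<le> N \<and> height i \<in> B. wt i * f (height i))"
proof -
  have [measurable]: "B \<in> sets borel" by fact
  have "(LINT t:B|\<sigma>. f t) = (\<Sum>i\<le>N. wt i * (indicator B (height i) * f (height i)))"
    unfolding \<sigma>_def set_lebesgue_integral_def
    by (subst integral_distr) (auto simp: lebesgue_integral_point_measure_finite wt_nonneg)
  also have "\<dots> = (\<Sum>i | i \<le> N \<and> height i \<in> B. wt i * f (height i))"
    by (intro sum.mono_neutral_cong_right) auto
  finally show ?thesis .
qed

lemma prob_space_\<nu>: "prob_space \<nu>"
  unfolding \<nu>_def using \<eta>_pos by (intro prob_space_uniform_measure) auto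

lemma prob_space_\<sigma>: "prob_space \<sigma>"
  unfolding \<sigma>_def
proof (rule prob_space.prob_space_distr)
  show "prob_space (point_measure {..N} (\<lambda>i. ennreal (wt i)))"
    using sum_wt wt_nonneg by (intro prob_space_point_measure) auto
qed auto

lemma prob_space_\<mu>: "prob_space \<mu>"
proof -
  interpret N: prob_space \<nu> by (rule prob_space_\<nu>)
  interpret S: prob_space \<sigma> by (rule prob_space_\<sigma>)
  interpret pair_prob_space \<nu> \<sigma> ..
  show ?thesis unfolding \<mu>_def by (rule prob_space_axioms)
qed

lemma measure_\<mu>:
  assumes "A \<in> sets borel" "B \<in> sets borel"
  shows "measure \<mu> (A \<times> B) = measure \<nu> A * measure \<sigma> B"
proof -
  interpret S: prob_space \<sigma> by (rule prob_space_\<sigma>)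
  show ?thesis
    using assms by (simp add: \<mu>_def measure_def S.emeasure_pair_measure_Times enn2real_mult)
qed

lemma spt_\<mu>: "spt \<mu> \<subseteq> {\<eta> / 3..2 * \<eta> / 3} \<times> height ` {..N}"
proof (rule spt_subset_closed)
  interpret prob_space \<mu> by (rule prob_space_\<mu>)
  let ?K = "{\<eta> / 3..2 * \<eta> / 3} \<times> height ` {..N}"
  have cl: "closed (height ` {..N})"
    by (intro finite_imp_closed) auto
  then show K: "closed ?K"
    by (intro closed_Times) auto
  have "measure \<mu> ?K = measure \<nu> {\<eta> / 3..2 * \<eta> / 3} * measure \<sigma> (height ` {..N})"
    using cl by (intro measure_\<mu>) auto
  also have "measure \<nu> {\<eta> / 3..2 * \<eta> / 3} = 1"
    using \<eta>_pos by (subst measure_\<nu>) auto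
  also have "measure \<sigma> (height ` {..N}) = 1"
    using cl sum_wt by (subst measure_\<sigma>) (auto simp: atMost_def intro: back_subst[of "\<lambda>A. sum wt A = 1"])
  finally have 1: "measure \<mu> ?K = 1" by simp
  have "space \<mu> = UNIV"
    using sets_eq_imp_space_eq[OF sets_\<mu>] by simp
  then show "emeasure \<mu> (- ?K) = 0"
    using prob_compl[of ?K] K 1 by (simp add: emeasure_eq_measure Compl_eq_Diff_UNIV borel_closed)
qed simp

section \<open>Beta numbers of \<open>\<mu>\<close> and masses of dyadic intervals\<close>

text \<open>The free \<open>c\<close> is the height of the test line: \<open>0\<close> if the heavy
  line is in the strip, the height of the only line if there is just one.\<close>

lemma beta2_triple_le:
  fixes j k l :: int
  defines "S \<equiv> {i. i \<le> N \<and> height i \<in> {(of_int l - 1) * dyadic_len j ..< (of_int l + 2) * dyadic_len j}}"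
  shows "(beta2 \<mu> (dyadic_triple j k l))\<^sup>2 \<le>
    (\<Sum>i\<in>S. wt i * (height i - c)\<^sup>2) / ((dyadic_len j)\<^sup>2 * sum wt S)"
proof -
  let ?B = "{(of_int l - 1) * dyadic_len j ..< (of_int l + 2) * dyadic_len j}"
  have "(beta2 \<mu> (dyadic_triple j k l))\<^sup>2
      \<le> (LINT t:?B|\<sigma>. (t - c)\<^sup>2) / ((diameter (dyadic_triple j k l))\<^sup>2 * measure \<sigma> ?B)"
    unfolding \<mu>_def dyadic_triple_def
    by (rule beta2_pair_measure_le) (auto simp: prob_space_\<nu> prob_space_\<sigma>)
  also have "\<dots> = (\<Sum>i\<in>S. wt i * (height i - c)\<^sup>2) / ((diameter (dyadic_triple j k l))\<^sup>2 * sum wt S)"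
    unfolding S_def by (simp add: measure_\<sigma> integral_\<sigma>)
  also have "\<dots> \<le> (\<Sum>i\<in>S. wt i * (height i - c)\<^sup>2) / ((dyadic_len j)\<^sup>2 * sum wt S)"
  proof (cases "sum wt S = 0")
    case False
    then have "0 < sum wt S"
      using sum_nonneg[of S wt] wt_nonneg by fastforce
    moreover have "(dyadic_len j)\<^sup>2 \<le> (diameter (dyadic_triple j k l))\<^sup>2"
      by (intro power_mono diameter_dyadic_triple_ge) (simp add: less_imp_le)
    moreover have "0 < dyadic_len j" "0 < diameter (dyadic_triple j k l)"
      using less_le_trans[OF dyadic_len_pos diameter_dyadic_triple_ge[of j k l]] by auto
    ultimately show ?thesis
      by (intro divide_left_mono mult_right_mono sum_nonneg mult_nonneg_nonneg wt_nonneg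
          mult_pos_pos zero_less_power) (auto simp: power_mono less_imp_le)
  qed simp
  finally show ?thesis .
qed

lemma beta2_single_line:
  assumes "\<And>i. i \<le> N \<Longrightarrow>
      height i \<in> {(of_int l - 1) * dyadic_len j ..< (of_int l + 2) * dyadic_len j} \<Longrightarrow> i = i0"
  shows "(beta2 \<mu> (dyadic_triple j k l))\<^sup>2 \<le> 0"
proof -
  have "(\<Sum>i | i \<le> N \<and> height i \<in> {(of_int l - 1) * dyadic_len j ..< (of_int l + 2) * dyadic_len j}.
      wt i * (height i - height i0)\<^sup>2) = 0"
    using assms by (intro sum.neutral) auto
  then show ?thesis
    using beta2_triple_le[of j k l "height i0"] by (simp only: div_0)
qed

text \<open>Each height is \<open>(1 / 2) ^ e\<close> times \<open>dyadic_len j\<close>, with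
  different exponents \<open>e\<close> for different lines. In its square one factor
  \<open>(1 / 2) ^ e\<close> is bounded by \<open>1\<close>, and the other ones sum to at most
  \<open>2\<close>.\<close>

lemma sum_height_sq_le:
  "(\<Sum>i | 1 \<le> i \<and> i \<le> N \<and> j \<le> int m + 2 * int i. (height i)\<^sup>2) \<le> 2 * (dyadic_len j)\<^sup>2"
proof -
  let ?S = "{i. 1 \<le> i \<and> i \<le> N \<and> j \<le> int m + 2 * int i}"
  let ?e = "\<lambda>i. nat (int m + 2 * int i - j)"
  have fin: "finite ?S"
    by (rule finite_subset[of _ "{..N}"]) auto
  have "(height i)\<^sup>2 \<le> (1 / 2) ^ ?e i * (dyadic_len j)\<^sup>2" if "i \<in> ?S" for i
  proof -
    have "dyadic_len j = 2 ^ ?e i * height i"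
      using that dyadic_len_diff_nat[of "int m + 2 * int i" "?e i"] by (simp add: height_def)
    then have "height i = (1 / 2) ^ ?e i * dyadic_len j"
      by (simp add: power_one_over)
    then have "(height i)\<^sup>2 = (1 / 2) ^ ?e i * ((1 / 2) ^ ?e i * (dyadic_len j)\<^sup>2)"
      by (simp add: power2_eq_square)
    also have "\<dots> \<le> (1 / 2) ^ ?e i * (1 * (dyadic_len j)\<^sup>2)"
      by (intro mult_left_mono mult_right_mono power_le_one) auto
    finally show ?thesis by simp
  qed
  then have "(\<Sum>i\<in>?S. (height i)\<^sup>2) \<le> (\<Sum>i\<in>?S. (1 / 2) ^ ?e i * (dyadic_len j)\<^sup>2)"
    by (rule sum_mono)
  also have "\<dots> = (\<Sum>i\<in>?S. (1 / 2) ^ ?e i) * (dyadic_len j)\<^sup>2"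
    by (simp add: sum_distrib_right)
  also have "\<dots> \<le> 2 * (dyadic_len j)\<^sup>2"
    using fin by (intro mult_right_mono sum_half_powers_le) (auto simp: inj_on_def)
  finally show ?thesis .
qed

text \<open>The heavy line itself is the test line: it adds nothing to the numerator and at least
  \<open>h\<close> to the mass. The light lines in the strip have heights at most
  \<open>dyadic_len j\<close>, so their squared distances form a geometric sum, and the bound does
  not depend on \<open>N\<close>.\<close>

lemma beta2_near_heavy_line:
  fixes l :: int
  assumes "0 \<in> {(of_int l - 1) * dyadic_len j ..< (of_int l + 2) * dyadic_len j}"
    and "\<And>i. 1 \<le> i \<Longrightarrow> i \<le> N \<Longrightarrow>
      height i \<in> {(of_int l - 1) * dyadic_len j ..< (of_int l + 2) * dyadic_len j} \<Longrightarrow>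
      j \<le> int m + 2 * int i"
  shows "(beta2 \<mu> (dyadic_triple j k l))\<^sup>2 \<le> 2 * w / h"
proof -
  let ?B = "{(of_int l - 1) * dyadic_len j ..< (of_int l + 2) * dyadic_len j}"
  let ?S = "{i. i \<le> N \<and> height i \<in> ?B}"
  let ?T = "{i. 1 \<le> i \<and> i \<le> N \<and> j \<le> int m + 2 * int i}"
  have "0 \<in> ?S"
    using assms(1) by (simp add: height_def)
  then have hS: "h \<le> sum wt ?S"
    using member_le_sum[of 0 ?S wt] wt_nonneg by (simp add: wt_def[of 0])
  have "(\<Sum>i\<in>?S. wt i * (height i - 0)\<^sup>2) = (\<Sum>i\<in>?S - {0}. wt i * (height i)\<^sup>2)"
    by (intro sum.mono_neutral_cong_right) (auto simp: height_def)
  also have "\<dots> = (\<Sum>i\<in>?S - {0}. w * (height i)\<^sup>2)"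
    by (intro sum.cong) (auto simp: wt_def)
  also have "\<dots> \<le> (\<Sum>i\<in>?T. w * (height i)\<^sup>2)"
    using w_pos assms(2)
    by (intro sum_mono2) (auto intro: finite_subset[of _ "{..N}"] simp: less_imp_le)
  also have "\<dots> \<le> w * (2 * (dyadic_len j)\<^sup>2)"
    unfolding sum_distrib_left[symmetric] using w_pos
    by (intro mult_left_mono sum_height_sq_le) auto
  finally have num: "(\<Sum>i\<in>?S. wt i * (height i - 0)\<^sup>2) \<le> w * (2 * (dyadic_len j)\<^sup>2)" .
  have "(beta2 \<mu> (dyadic_triple j k l))\<^sup>2
      \<le> (\<Sum>i\<in>?S. wt i * (height i - 0)\<^sup>2) / ((dyadic_len j)\<^sup>2 * sum wt ?S)"
    by (rule beta2_triple_le)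
  also have "\<dots> \<le> w * (2 * (dyadic_len j)\<^sup>2) / ((dyadic_len j)\<^sup>2 * h)"
    using num hS h w_pos by (intro frac_le mult_left_mono) auto
  also have "\<dots> = 2 * w / h"
    by simp
  finally show ?thesis .
qed

text \<open>The end points \<open>\<eta> / 3\<close> and \<open>2 * \<eta> / 3\<close> stay at relative distance at least \<open>1 / 3\<close> from
  the dyadic points of every scale below \<open>\<eta>\<close>.\<close>

lemma measure_\<nu>_dyadic_ge:
  fixes k :: int
  assumes "int m \<le> j" and x: "x \<in> {\<eta> / 3..2 * \<eta> / 3}"
    and xI: "x \<in> {of_int k * dyadic_len j ..< (of_int k + 1) * dyadic_len j}"
  shows "dyadic_len j / \<eta> \<le> measure \<nu> {of_int k * dyadic_len j ..< (of_int k + 1) * dyadic_len j}"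
proof -
  let ?l = "dyadic_len j" and ?e = "nat (j - int m)"
  let ?I = "{of_int k * ?l ..< (of_int k + 1) * ?l}"
  define a b where "a = max (\<eta> / 3) (of_int k * ?l)" and "b = min (2 * \<eta> / 3) ((of_int k + 1) * ?l)"
  have l: "0 < ?l" by simp
  \<comment> \<open>As \<open>\<eta>\<close> is an integer multiple of \<open>?l\<close>,
    comparisons of end points become integer inequalities, where a strict one gains
    \<open>1\<close>; after division by 3 this gives overlap \<open>?l / 3\<close>.\<close>
  have \<eta>: "\<eta> = of_int (2 ^ ?e) * ?l"
    using dyadic_len_diff_nat[of j ?e] assms(1) by (simp add: \<eta>_def)
  have "\<eta> < 3 * ((of_int k + 1) * ?l)"
    using x xI by auto
  then have "of_int (2 ^ ?e) * ?l < of_int (3 * (k + 1)) * ?l"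
    unfolding \<eta>[symmetric] by (simp add: algebra_simps)
  then have k1: "2 ^ ?e + 1 \<le> 3 * (k + 1)"
    using l by (simp only: mult_less_cancel_right_pos of_int_less_iff)
  have "3 * (of_int k * ?l) \<le> 2 * \<eta>"
    using x xI by auto
  also have "2 * \<eta> = of_int (2 ^ Suc ?e) * ?l"
    by (simp add: \<eta>)
  finally have "of_int (3 * k) * ?l \<le> of_int (2 ^ Suc ?e) * ?l"
    by simp
  then have "3 * k \<le> 2 ^ Suc ?e"
    using l by (simp only: mult_le_cancel_right_pos of_int_le_iff)
  \<comment> \<open>Equality would put the left end of the dyadic interval at
    \<open>2 * \<eta> / 3\<close>, so that it meets the segment in one point only.\<close>
  moreover have "3 * k \<noteq> 2 ^ Suc ?e"
  proof
    assume "3 * k = 2 ^ Suc ?e"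
    then have "(3::int) dvd 2 ^ Suc ?e" by (metis dvd_triv_left)
    then have "(3::int) dvd 2"
      by (rule prime_dvd_power[rotated]) simp
    then show False by simp
  qed
  ultimately have k2: "3 * k + 1 \<le> 2 * 2 ^ ?e" by simp
  have k3: "(1::int) \<le> 2 ^ ?e" by simp
  have le: "of_int p * ?l \<le> of_int q * ?l" if "p \<le> q" for p q :: int
    using that l by simp
  \<comment> \<open>There are four cases for \<open>b - a\<close>: \<open>k1\<close>,
    \<open>k2\<close> and \<open>k3\<close> handle the three that involve an end of the segment, and
    in the fourth \<open>b - a\<close> is \<open>?l\<close>.\<close>
  have "?l / 3 \<le> b - a"
    using le[OF k1] le[OF k2] le[OF k3] l unfolding a_def b_def \<eta>
    by (auto simp: max_def min_def algebra_simps)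
  also have "b - a = measure lborel {a..<b}"
    using order_trans[OF _ \<open>?l / 3 \<le> b - a\<close>, of 0] l by (subst measure_lborel_Ico) auto
  also have "\<dots> \<le> measure lborel ({\<eta> / 3..2 * \<eta> / 3} \<inter> ?I)"
    by (intro measure_mono_fmeasurable fmeasurable.Int)
       (auto simp: a_def b_def fmeasurable_def emeasure_lborel_Icc_eq)
  finally have "?l / 3 * 3 / \<eta> \<le> measure lborel ({\<eta> / 3..2 * \<eta> / 3} \<inter> ?I) * 3 / \<eta>"
    using \<eta>_pos by (intro divide_right_mono mult_right_mono) auto
  then show ?thesis
    by (simp add: measure_\<nu>)
qed

lemma measure_\<nu>_interval_le:
  assumes "a \<le> b"
  shows "measure \<nu> {a..b} \<le> (b - a) * 3 / \<eta>"
proof -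
  have "measure lborel ({\<eta> / 3..2 * \<eta> / 3} \<inter> {a..b}) \<le> measure lborel {a..b}"
    by (intro measure_mono_fmeasurable) (auto simp: fmeasurable_def emeasure_lborel_Icc_eq)
  also have "\<dots> = b - a" using assms by simp
  finally have "measure lborel ({\<eta> / 3..2 * \<eta> / 3} \<inter> {a..b}) * 3 / \<eta> \<le> (b - a) * 3 / \<eta>"
    using \<eta>_pos by (intro divide_right_mono mult_right_mono) auto
  then show ?thesis
    by (simp add: measure_\<nu>)
qed

section \<open>The Jones function of \<open>\<mu>\<close>\<close>

lemma dyadic_interval_0:
  fixes l :: int
  assumes "0 \<le> t" "t < dyadic_len j"
    and "t \<in> {of_int l * dyadic_len j ..< (of_int l + 1) * dyadic_len j}"
  shows "l = 0"
  using assms by (intro dyadic_interval_unique[of t]) auto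

text \<open>At scales from \<open>\<eta>\<close> upwards the square at the origin carries the whole
  mass \<open>1\<close>. All heights are below \<open>\<eta>\<close>, so the term is at most
  \<open>\<eta>\<^sup>2 / dyadic_len j\<close>, which is geometric in \<open>j\<close>.\<close>

lemma jones_term_coarse:
  assumes j: "j \<le> int m" and z: "(x, t) \<in> spt \<mu>" "(x, t) \<in> dyadic_square j k l"
  shows "ennreal ((beta2 \<mu> (dyadic_triple j k l))\<^sup>2) *
      (ennreal (dyadic_len j) / emeasure \<mu> (dyadic_square j k l))
    \<le> ennreal (\<eta> * (1 / 2) ^ nat (int m - j))"
proof -
  let ?l = "dyadic_len j"
  have le: "\<eta> \<le> ?l"
    using j by (simp add: \<eta>_def)
  have ht: "height i < ?l" for i
    using height_less[of i] le by simp
  have x: "0 \<le> x" "x < ?l" and t: "0 \<le> t" "t < ?l"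
    using z(1) spt_\<mu> le \<eta>_pos height_nonneg ht by (auto dest!: subsetD)
  then have kl: "k = 0" "l = 0"
    using z(2) by (auto simp: dyadic_square_def intro: dyadic_interval_0)
  let ?S = "{i. i \<le> N \<and> height i \<in> {(of_int l - 1) * ?l ..< (of_int l + 2) * ?l}}"
  have "height i \<in> {(of_int l - 1) * ?l ..< (of_int l + 2) * ?l}" for i
    using height_nonneg[of i] ht[of i] dyadic_len_pos[of j] by (auto simp: kl)
  then have S: "?S = {..N}" by auto
  have "(\<Sum>i\<in>?S. wt i * (height i - 0)\<^sup>2) \<le> (\<Sum>i\<in>{..N}. wt i * \<eta>\<^sup>2)"
    unfolding S using height_nonneg height_less
    by (intro sum_mono mult_left_mono wt_nonneg power_mono) (auto simp: less_imp_le)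
  also have "\<dots> = \<eta>\<^sup>2"
    by (simp add: sum_wt flip: sum_distrib_right)
  finally have num: "(\<Sum>i\<in>?S. wt i * (height i - 0)\<^sup>2) \<le> \<eta>\<^sup>2" .
  have "(beta2 \<mu> (dyadic_triple j k l))\<^sup>2 \<le> (\<Sum>i\<in>?S. wt i * (height i - 0)\<^sup>2) / (?l\<^sup>2 * sum wt ?S)"
    by (rule beta2_triple_le)
  also have "\<dots> \<le> \<eta>\<^sup>2 / (?l\<^sup>2 * 1)"
    unfolding S sum_wt using num unfolding S by (intro divide_right_mono) auto
  finally have b: "(beta2 \<mu> (dyadic_triple j k l))\<^sup>2 \<le> \<eta>\<^sup>2 / ?l\<^sup>2" by simp
  have "{\<eta> / 3..2 * \<eta> / 3} \<inter> {0..<?l} = {\<eta> / 3..2 * \<eta> / 3}"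
    using \<eta>_pos le by auto
  then have n: "measure \<nu> {0..<?l} = 1"
    using \<eta>_pos by (simp add: measure_\<nu>)
  have "{i. i \<le> N \<and> height i \<in> {0..<?l}} = {..N}"
    using height_nonneg ht by auto
  then have "measure \<sigma> {0..<?l} = 1"
    using sum_wt by (subst measure_\<sigma>) simp_all
  then have "measure \<mu> (dyadic_square j k l) = 1"
    using n by (simp add: dyadic_square_def kl measure_\<mu>)
  then have "ennreal ((beta2 \<mu> (dyadic_triple j k l))\<^sup>2) *
      (ennreal (dyadic_len j) / emeasure \<mu> (dyadic_square j k l)) \<le> ennreal (\<eta>\<^sup>2 / ?l\<^sup>2 * ?l / 1)"
    using b by (intro jones_term_le prob_space.finite_measure prob_space_\<mu>) (auto simp: less_imp_le)
  also have "\<eta>\<^sup>2 / ?l\<^sup>2 * ?l / 1 = \<eta> * (1 / 2) ^ nat (int m - j)"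
    using dyadic_len_diff_nat[of "int m" "nat (int m - j)"] j \<eta>_pos
    by (simp add: \<eta>_def power2_eq_square power_one_over)
  finally show ?thesis .
qed

text \<open>A line \<open>i\<close> in the row of the square contributes mass at least
  \<open>wt i * dyadic_len j / \<eta>\<close>. It may differ from the line through the given point,
  so the heavy one is used whenever it is in the row.\<close>

lemma jones_term_fine:
  fixes k l :: int
  assumes j: "int m < j" and z: "(x, t) \<in> spt \<mu>" "(x, t) \<in> dyadic_square j k l"
    and i: "i \<le> N" "height i \<in> {of_int l * dyadic_len j ..< (of_int l + 1) * dyadic_len j}"
    and v: "(beta2 \<mu> (dyadic_triple j k l))\<^sup>2 \<le> v"
  shows "ennreal ((beta2 \<mu> (dyadic_triple j k l))\<^sup>2) *
      (ennreal (dyadic_len j) / emeasure \<mu> (dyadic_square j k l))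
    \<le> ennreal (v * \<eta> / wt i)"
proof -
  let ?l = "dyadic_len j"
  let ?I = "{of_int k * ?l ..< (of_int k + 1) * ?l}" and ?J = "{of_int l * ?l ..< (of_int l + 1) * ?l}"
  have wt: "0 < wt i"
    using h w_pos by (simp add: wt_def)
  have "wt i \<le> measure \<sigma> ?J"
    using member_le_sum[of i "{i. i \<le> N \<and> height i \<in> ?J}" wt] i wt_nonneg by (simp add: measure_\<sigma>)
  moreover have "?l / \<eta> \<le> measure \<nu> ?I"
    using j z spt_\<mu> by (intro measure_\<nu>_dyadic_ge[of j x]) (auto simp: dyadic_square_def)
  ultimately have "?l / \<eta> * wt i \<le> measure \<nu> ?I * measure \<sigma> ?J"
    using wt \<eta>_pos by (intro mult_mono) auto
  then have "?l / \<eta> * wt i \<le> measure \<mu> (dyadic_square j k l)"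
    by (simp add: dyadic_square_def measure_\<mu>)
  then have "ennreal ((beta2 \<mu> (dyadic_triple j k l))\<^sup>2) *
      (ennreal ?l / emeasure \<mu> (dyadic_square j k l)) \<le> ennreal (v * ?l / (?l / \<eta> * wt i))"
    using v wt \<eta>_pos by (intro jones_term_le prob_space.finite_measure prob_space_\<mu>) (auto simp: less_imp_le)
  then show ?thesis by simp
qed

lemma density_jones_\<mu>_le:
  assumes z: "z \<in> spt \<mu>"
  shows "density_jones \<mu> z \<le> ennreal (2 * \<eta> + 4 * \<eta> / h\<^sup>2 + 2 * \<eta> / h)"
proof -
  obtain x t i where zi: "z = (x, t)" "i \<le> N" "t = height i" "x \<in> {\<eta> / 3..2 * \<eta> / 3}"
    using subsetD[OF spt_\<mu> z] by (auto elim!: SigmaE)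
  have z': "(x, t) \<in> spt \<mu>" using z zi by simp
  \<comment> \<open>\<open>g1\<close> pays for the scales from \<open>\<eta>\<close> upwards,
    \<open>g2\<close> for the \<open>2 * N\<close> finer scales at which the square lies on the
    heavy line with light lines possibly near, and \<open>g3\<close> for the single scale at which
    the light line through \<open>z\<close> separates from the heavy one.\<close>
  define g1 g2 g3 where "g1 = (\<lambda>j. if j \<le> int m then \<eta> * (1 / 2) ^ nat (int m - j) else 0)"
    and "g2 = (\<lambda>j. if int m < j \<and> j \<le> int m + 2 * int N then 2 * w / h * \<eta> / h else 0)"
    and "g3 = (\<lambda>j. if j = int m + 2 * int i then 2 * w / h * \<eta> / w else 0)"
  have g: "0 \<le> g1 j" "0 \<le> g2 j" "0 \<le> g3 j" for j
    using \<eta>_pos h w_pos by (auto simp: g1_def g2_def g3_def)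
  show ?thesis
  proof (rule density_jones_le[where g = "\<lambda>j. g1 j + g2 j + g3 j"])
    fix j k l
    assume "z \<in> dyadic_square j k l"
    then have zQ: "(x, t) \<in> dyadic_square j k l" by (simp add: zi)
    let ?l = "dyadic_len j"
    let ?J = "{of_int l * ?l ..< (of_int l + 1) * ?l}"
      and ?T = "{(of_int l - 1) * ?l ..< (of_int l + 2) * ?l}"
    let ?term = "ennreal ((beta2 \<mu> (dyadic_triple j k l))\<^sup>2) *
        (ennreal (dyadic_len j) / emeasure \<mu> (dyadic_square j k l))"
    have l: "0 < ?l" by simp
    have tJ: "t \<in> ?J" using zQ by (simp add: dyadic_square_def)
    have "?term \<le> ennreal (g1 j) \<or> ?term \<le> ennreal (g2 j) \<or> ?term \<le> ennreal (g3 j)"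
    proof (cases "j \<le> int m")
      case True
      then show ?thesis
        using jones_term_coarse[OF True z' zQ] by (simp add: g1_def)
    next
      case False
      then have j: "int m < j" by simp
      show ?thesis
      proof (cases "t < ?l")
        \<comment> \<open>The square is in the row \<open>l = 0\<close>, whose closed lower edge
          contains the heavy line.\<close>
        case True
        then have l0: "l = 0"
          using tJ height_nonneg zi by (intro dyadic_interval_0[of t]) auto
        have 0: "height 0 \<in> ?J"
          by (simp add: l0 height_def)
        have near: "j \<le> int m + 2 * int r" if "1 \<le> r" "height r \<in> ?T" for r
        proof -
          \<comment> \<open>The strip \<open>?T\<close> ends at \<open>2 * ?l\<close>, the length
            one scale up; hence \<open>j - 1 < int m + 2 * int r\<close>, which is the claim in
            integers.\<close>
          have "height r < dyadic_len (j - int 1)"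
            using that by (simp only: dyadic_len_diff_nat) (simp add: l0)
          then show ?thesis using that by (simp add: height_def)
        qed
        show ?thesis
        proof (cases "j \<le> int m + 2 * int N")
          case True
          have "(beta2 \<mu> (dyadic_triple j k l))\<^sup>2 \<le> 2 * w / h"
            using near by (intro beta2_near_heavy_line) (auto simp: l0 less_imp_le)
          from jones_term_fine[OF j z' zQ _ 0 this] show ?thesis
            using True j by (simp add: g2_def wt_def)
        next
          case False
          \<comment> \<open>Every light line is now above the strip. With vanishing beta the whole
            term is \<open>0\<close> in \<open>ennreal\<close>.\<close>
          have "(beta2 \<mu> (dyadic_triple j k l))\<^sup>2 \<le> 0"
          proof (rule beta2_single_line[where ?i0.0 = 0])
            show "r = 0" if "r \<le> N" "height r \<in> ?T" for r
              using near[of r] that False by (cases "r = 0") auto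
          qed
          then show ?thesis by simp
        qed
      next
        case False
        then have i1: "1 \<le> i"
          using zi l by (cases i) (auto simp: height_def)
        then have t: "t = dyadic_len (int m + 2 * int i)"
          using zi by (simp add: height_def)
        then have ji: "int m + 2 * int i \<le> j"
          using False by simp
        define e where "e = nat (j - (int m + 2 * int i))"
        \<comment> \<open>The light line runs along the lower edge of its square, and
          \<open>e\<close> counts the scales since it left the row of the heavy line.\<close>
        have te: "t = of_int (2 ^ e) * ?l"
          using dyadic_len_diff_nat[of j e] ji by (simp add: t e_def)
        then have le: "l = 2 ^ e"
          using tJ l by (intro dyadic_interval_unique[OF tJ]) auto
        have iJ: "height i \<in> ?J" using tJ zi by simp
        show ?thesis
        proof (cases "e = 0")
          case True
          \<comment> \<open>The strip is from \<open>0\<close> to \<open>3 * ?l\<close> and still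
            contains the heavy line on its closed lower edge, but the square itself does not, so its
            mass is measured with \<open>w\<close>.\<close>
          then have l1: "l = 1" and ji': "j = int m + 2 * int i"
            using le ji by (auto simp: e_def)
          have "(beta2 \<mu> (dyadic_triple j k l))\<^sup>2 \<le> 2 * w / h"
          proof (rule beta2_near_heavy_line)
            show "j \<le> int m + 2 * int r" if "1 \<le> r" "height r \<in> ?T" for r
            proof -
              \<comment> \<open>Rounding \<open>3 * ?l\<close> up to a dyadic length gives
                \<open>j - 2 < int m + 2 * int r\<close>; since \<open>j - int m\<close> is even,
                this improves to \<open>j \<le> int m + 2 * int r\<close>.\<close>
              have "height r < 4 * ?l"
                using that l by (simp add: l1)
              also have "4 * ?l = dyadic_len (j - int 2)"
                by (simp only: dyadic_len_diff_nat) simp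
              finally show ?thesis using that ji' by (simp add: height_def)
            qed
          qed (auto simp: l1)
          from jones_term_fine[OF j z' zQ _ iJ this] show ?thesis
            using ji' zi i1 by (simp add: g3_def wt_def)
        next
          case False
          then have ji': "int m + 2 * int i < j"
            using ji by (simp add: e_def)
          have "?l \<le> dyadic_len (int m + 2 * int i + 1)"
            using ji' by simp
          then have lt: "2 * ?l \<le> t"
            using dyadic_len_diff_nat[of "int m + 2 * int i + 1" 1] by (simp add: t)
          have "(beta2 \<mu> (dyadic_triple j k l))\<^sup>2 \<le> 0"
          proof (rule beta2_single_line[where ?i0.0 = i])
            show "r = i" if "r \<le> N" "height r \<in> ?T" for r
            proof -
              have b: "t - ?l \<le> height r" "height r < t + 2 * ?l"
                using that te by (auto simp: le algebra_simps)
              \<comment> \<open>As \<open>2 * ?l \<le> t\<close>, the strip lies between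
                \<open>t / 2\<close> and \<open>2 * t\<close>. Positivity excludes the heavy line,
                and the ratio 4 of the heights excludes the other light ones.\<close>
              have b': "t \<le> 2 * height r" "height r < 2 * t" "0 < height r"
                using b lt l by linarith+
              have r: "height r = dyadic_len (int m + 2 * int r)"
                using b'(3) by (simp add: height_def split: if_splits)
              have "height r < dyadic_len (int m + 2 * int i - int 1)"
                using b'(2) by (simp only: dyadic_len_diff_nat t) simp
              moreover have "t \<le> dyadic_len (int m + 2 * int r - int 1)"
                using b'(1) by (simp only: dyadic_len_diff_nat r) simp
              ultimately show ?thesis
                unfolding r t by simp
            qed
          qed
          then show ?thesis by simp
        qed
      qed
    qed
    moreover have "ennreal (g1 j) \<le> ennreal (g1 j + g2 j + g3 j)"
      "ennreal (g2 j) \<le> ennreal (g1 j + g2 j + g3 j)"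
      "ennreal (g3 j) \<le> ennreal (g1 j + g2 j + g3 j)"
      using g[of j] by (auto intro!: ennreal_leI)
    ultimately show "?term \<le> ennreal (g1 j + g2 j + g3 j)"
      by (meson order_trans)
  next
    fix F :: "int set"
    assume F: "finite F"
    have "sum g1 F = (\<Sum>j\<in>{j\<in>F. j \<le> int m}. \<eta> * (1 / 2) ^ nat (int m - j))"
      unfolding g1_def using F by (intro sum.inter_filter[symmetric])
    also have "\<dots> \<le> \<eta> * 2"
      unfolding sum_distrib_left[symmetric] using F \<eta>_pos
      by (intro mult_left_mono sum_half_powers_le) (auto simp: inj_on_def)
    finally have 1: "sum g1 F \<le> 2 * \<eta>" by simp
    let ?A = "{int m<..int m + 2 * int N}"
    have "sum g2 F \<le> sum g2 (F \<union> ?A)"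
      using F g by (intro sum_mono2) auto
    also have "\<dots> = (\<Sum>j\<in>?A. 2 * w / h * \<eta> / h)"
      using F by (intro sum.mono_neutral_cong_right) (auto simp: g2_def)
    \<comment> \<open>The number \<open>2 * N\<close> of scales is compensated by the light mass
      \<open>w\<close>, because \<open>real N * w\<close> is the total light mass
      \<open>1 - h\<close>.\<close>
    also have "\<dots> = 4 * (real N * w) * \<eta> / h\<^sup>2"
      by (simp add: power2_eq_square)
    also have "real N * w = 1 - h"
      using N by (simp add: w_def)
    also have "4 * (1 - h) * \<eta> / h\<^sup>2 \<le> 4 * 1 * \<eta> / h\<^sup>2"
      using h \<eta>_pos by (intro divide_right_mono mult_right_mono mult_left_mono) auto
    finally have 2: "sum g2 F \<le> 4 * \<eta> / h\<^sup>2" by simp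
    have "sum g3 F = (if int m + 2 * int i \<in> F then 2 * w / h * \<eta> / w else 0)"
      unfolding g3_def using F by (rule sum.delta)
    also have "\<dots> \<le> 2 * \<eta> / h"
      using h \<eta>_pos w_pos by simp
    finally show "(\<Sum>j\<in>F. g1 j + g2 j + g3 j) \<le> 2 * \<eta> + 4 * \<eta> / h\<^sup>2 + 2 * \<eta> / h"
      using 1 2 by (simp add: sum.distrib)
  qed (use g in auto)
qed

section \<open>Mass of sets of length at most 1\<close>

text \<open>The heavy line is given away at cost \<open>h\<close>. On the light lines a cover by
  sets of diameter at most \<open>\<delta>\<close> is used: each set meets at most one of them and
  catches mass at most \<open>6 * w / \<eta>\<close> times its diameter.\<close>

lemma outer_measure_\<mu>_le:
  assumes \<Gamma>: "hausdorff1 \<Gamma> \<le> 1"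
  shows "outer_measure_of \<mu> \<Gamma> \<le> ennreal (h + 12 * w / \<eta>)"
proof -
  interpret prob_space \<mu> by (rule prob_space_\<mu>)
  let ?Y = "height ` {1..N}"
  have Y: "?Y \<in> sets borel"
    by (intro borel_closed finite_imp_closed) auto
  \<comment> \<open>Half of the lowest light height. Two light lines differ by at least three times
    the lower height, hence by more than \<open>\<delta>\<close>.\<close>
  define \<delta> where "\<delta> = dyadic_len (int m + 2 * int N + 1)"
  have \<delta>: "0 < \<delta>" by (simp add: \<delta>_def)
  have gap: "r = s" if "r \<in> {1..N}" "s \<in> {1..N}" "\<bar>height r - height s\<bar> \<le> \<delta>" for r s
  proof -
    have *: False if "r \<in> {1..N}" "s \<in> {1..N}" "\<bar>height r - height s\<bar> \<le> \<delta>" "r < s" for r s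
    proof -
      have "2 * \<delta> = dyadic_len (int m + 2 * int N)"
        using dyadic_len_diff_nat[of "int m + 2 * int N + 1" 1] by (simp add: \<delta>_def)
      then have s: "2 * \<delta> \<le> height s"
        using that by (simp add: height_def)
      have "dyadic_len (int m + 2 * int s - int 2) \<le> height r"
        using that by (simp add: height_def)
      then have "4 * height s \<le> height r"
        using that by (simp only: dyadic_len_diff_nat) (simp add: height_def)
      then show False
        using that(3) s \<delta> by linarith
    qed
    show ?thesis
      using *[of r s] *[of s r] that by (cases r s rule: linorder_cases) (auto simp: abs_minus_commute)
  qed
  have "hausdorff1_pre \<delta> \<Gamma> \<le> hausdorff1 \<Gamma>"
    unfolding hausdorff1_def using \<delta> by (intro SUP_upper) auto
  \<comment> \<open>The infimum over covers need not be attained; the slack from 1 to 2 provides an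
    actual cover.\<close>
  also have "\<dots> < 2"
    using \<Gamma> by (rule le_less_trans) simp
  finally obtain C :: "nat \<Rightarrow> (real \<times> real) set" where C: "\<Gamma> \<subseteq> (\<Union>n. C n)"
    "\<And>n. bounded (C n)" "\<And>n. diameter (C n) \<le> \<delta>" and sum: "(\<Sum>n. ennreal (diameter (C n))) < 2"
    unfolding hausdorff1_pre_def INF_less_iff by blast
  have "\<exists>B. B \<in> sets \<mu> \<and> C n \<inter> (UNIV \<times> ?Y) \<subseteq> B \<and>
      emeasure \<mu> B \<le> ennreal (6 * w / \<eta>) * ennreal (diameter (C n))" for n
  proof (cases "C n \<inter> (UNIV \<times> ?Y) = {}")
    case True
    then show ?thesis by (intro exI[of _ "{}"]) auto
  next
    case False
    then obtain x r where xr: "(x, height r) \<in> C n" "r \<in> {1..N}" by blast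
    define d where "d = diameter (C n)"
    have d0: "0 \<le> d"
      unfolding d_def using C(2) by (rule diameter_ge_0)
    \<comment> \<open>One point of \<open>C n\<close> on the line is known, so an interval of radius
      \<open>d\<close> around it suffices. Its length \<open>2 * d\<close> times the density
      \<open>3 / \<eta>\<close> of \<open>\<nu>\<close> yields the constant 6.\<close>
    let ?B = "{x - d..x + d} \<times> {height r}"
    have "C n \<inter> (UNIV \<times> ?Y) \<subseteq> ?B"
    proof
      fix z
      assume "z \<in> C n \<inter> (UNIV \<times> ?Y)"
      then obtain x' s where z: "z = (x', height s)" and s: "(x', height s) \<in> C n" "s \<in> {1..N}"
        by blast
      have d: "dist (x', height s) (x, height r) \<le> d"
        unfolding d_def using C(2) s(1) xr(1) by (rule diameter_bounded_bound)
      have "\<bar>x' - x\<bar> \<le> d" "\<bar>height s - height r\<bar> \<le> d"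
        using order_trans[OF dist_fst_le d] order_trans[OF dist_snd_le d] by (auto simp: dist_real_def)
      then show "z \<in> ?B"
        unfolding z using gap[OF s(2) xr(2)] C(3)[of n] by (auto simp: d_def)
    qed
    moreover have "emeasure \<mu> ?B \<le> ennreal (6 * w / \<eta>) * ennreal d"
    proof -
      have "{i. i \<le> N \<and> height i \<in> {height r}} = {r}"
        using xr(2) gap[of _ r] \<delta> by (auto simp: height_def split: if_splits)
      then have "measure \<sigma> {height r} = w"
        using xr(2) by (simp only: measure_\<sigma>[OF borel_singleton[OF sets.empty_sets]]) (simp add: wt_def)
      then have "measure \<mu> ?B = measure \<nu> {x - d..x + d} * w"
        by (subst measure_\<mu>) auto
      also have "\<dots> \<le> ((x + d - (x - d)) * 3 / \<eta>) * w"
        using d0 w_pos by (intro mult_right_mono measure_\<nu>_interval_le) auto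
      also have "\<dots> = 6 * w / \<eta> * d" by simp
      finally show ?thesis
        using w_pos \<eta>_pos d0 by (simp add: emeasure_eq_measure flip: ennreal_mult)
    qed
    moreover have "?B \<in> sets \<mu>"
      by (auto intro!: borel_closed closed_Times)
    ultimately show ?thesis by (auto simp: d_def)
  qed
  then obtain B where B: "\<And>n. B n \<in> sets \<mu>" "\<And>n. C n \<inter> (UNIV \<times> ?Y) \<subseteq> B n"
    "\<And>n. emeasure \<mu> (B n) \<le> ennreal (6 * w / \<eta>) * ennreal (diameter (C n))"
    by metis
  let ?H = "UNIV \<times> (- ?Y)"
  have "{i. i \<le> N \<and> height i \<in> - ?Y} = {0}"
    by (auto simp: height_def)
  then have "measure \<sigma> (- ?Y) = h"
    using Y by (subst measure_\<sigma>) (auto simp: wt_def)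
  then have H: "measure \<mu> ?H \<le> h"
    using Y h prob_space.prob_le_1[OF prob_space_\<nu>, of UNIV]
    by (subst measure_\<mu>) (auto simp: mult_left_le_one_le)
  have sH: "?H \<in> sets \<mu>"
    unfolding \<mu>_def using Y by (intro pair_measureI) auto
  have "outer_measure_of \<mu> \<Gamma> \<le> emeasure \<mu> (?H \<union> (\<Union>n. B n))"
  proof -
    have "\<Gamma> \<subseteq> ?H \<union> (\<Union>n. B n)"
    proof
      fix z
      assume "z \<in> \<Gamma>"
      then obtain n where "z \<in> C n" using C(1) by auto
      then show "z \<in> ?H \<union> (\<Union>n. B n)"
        using subsetD[OF B(2)[of n], of z] by (cases z) auto
    qed
    then show ?thesis
      unfolding outer_measure_of_def using B(1) sH by (intro INF_lower) auto
  qed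
  also have "\<dots> \<le> emeasure \<mu> ?H + emeasure \<mu> (\<Union>n. B n)"
    using B(1) sH by (intro emeasure_subadditive) auto
  also have "\<dots> \<le> ennreal h + (\<Sum>n. ennreal (6 * w / \<eta>) * ennreal (diameter (C n)))"
  proof (rule add_mono)
    show "emeasure \<mu> ?H \<le> ennreal h"
      using H by (simp add: emeasure_eq_measure ennreal_leI)
    have "emeasure \<mu> (\<Union>n. B n) \<le> (\<Sum>n. emeasure \<mu> (B n))"
      using B(1) by (intro emeasure_subadditive_countably) auto
    also have "\<dots> \<le> (\<Sum>n. ennreal (6 * w / \<eta>) * ennreal (diameter (C n)))"
      using B(3) by (intro suminf_le) auto
    finally show "emeasure \<mu> (\<Union>n. B n) \<le> (\<Sum>n. ennreal (6 * w / \<eta>) * ennreal (diameter (C n)))" .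
  qed
  also have "\<dots> \<le> ennreal h + ennreal (6 * w / \<eta>) * ennreal 2"
    unfolding ennreal_suminf_cmult using sum by (intro add_left_mono mult_left_mono) auto
  also have "\<dots> = ennreal (h + 12 * w / \<eta>)"
    using h w_pos \<eta>_pos by (subst ennreal_mult[symmetric]) (auto simp flip: ennreal_plus)
  finally show ?thesis .
qed

end

section \<open>Choice of the parameters\<close>

theorem theorem1p3:
  fixes \<epsilon> :: real
  assumes "\<epsilon> > 0"
  shows "\<exists>\<mu> :: (real \<times> real) measure.
    prob_space \<mu> \<and> radon_measure \<mu> \<and> spt \<mu> \<subseteq> {0..1} \<times> {0..1} \<and>
    (\<forall>x\<in>spt \<mu>. density_jones \<mu> x \<le> ennreal \<epsilon>) \<and>
    (\<forall>\<Gamma>. hausdorff1_measurable \<Gamma> \<longrightarrow> hausdorff1 \<Gamma> \<le> 1 \<longrightarrow>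
      outer_measure_of \<mu> \<Gamma> \<le> ennreal \<epsilon>)"
proof -
  \<comment> \<open>Half of \<epsilon> is reserved for the heavy line, half for the light ones; the
    minimum with 1 ensures \<open>h < 1\<close>.\<close>
  define h where "h = min \<epsilon> 1 / 2"
  have h: "0 < h" "h < 1" and h\<epsilon>: "2 * h \<le> \<epsilon>"
    using assms by (auto simp: h_def)
  define c where "c = 2 + 4 / h\<^sup>2 + 2 / h"
  have c: "0 < c" using h by (auto simp: c_def intro!: add_pos_pos)
  \<comment> \<open>The Jones bound is \<open>c * \<eta>\<close> with \<open>c\<close> depending on
    \<open>h\<close> only, so \<open>m\<close> can be fixed before the number of lines, which is
    then taken large in terms of \<open>h\<close> and \<open>m\<close>.\<close>
  obtain m :: nat where m: "(1 / 2) ^ m < \<epsilon> / c"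
    using real_arch_pow_inv[of "\<epsilon> / c" "1 / 2"] assms c by auto
  obtain N0 :: nat where N0: "12 * 2 ^ m / h \<le> real N0"
    using real_arch_simple by blast
  interpret light_lines m "Suc N0" h
    using h by unfold_locales auto
  have \<eta>: "\<eta> = (1 / 2) ^ m"
    by (simp add: \<eta>_def dyadic_len_def power_int_minus power_one_over field_simps)
  have "2 * \<eta> + 4 * \<eta> / h\<^sup>2 + 2 * \<eta> / h = c * \<eta>"
    by (simp add: c_def algebra_simps)
  also have "\<dots> \<le> \<epsilon>"
    using m c by (simp add: \<eta> field_simps)
  finally have jones: "2 * \<eta> + 4 * \<eta> / h\<^sup>2 + 2 * \<eta> / h \<le> \<epsilon>" .
  have "12 * 2 ^ m * (1 - h) \<le> 12 * 2 ^ m * 1"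
    using h by (intro mult_left_mono) auto
  also have "\<dots> \<le> h * real (Suc N0)"
    using N0 h by (simp add: field_simps)
  finally have "12 * w / \<eta> \<le> h"
    by (simp add: w_def \<eta> field_simps)
  then have outer: "h + 12 * w / \<eta> \<le> \<epsilon>"
    using h\<epsilon> by simp
  have "\<eta> \<le> 1"
    by (simp add: \<eta> power_le_one)
  then have "{\<eta> / 3..2 * \<eta> / 3} \<times> height ` {..Suc N0} \<subseteq> {0..1} \<times> {0..1}"
    using \<eta>_pos height_nonneg less_le_trans[OF height_less] by (auto simp: less_imp_le)
  then have "spt \<mu> \<subseteq> {0..1} \<times> {0..1}"
    using spt_\<mu> by blast
  moreover have "radon_measure \<mu>"
    using prob_space.finite_measure[OF prob_space_\<mu>] sets_\<mu> by (rule finite_borel_measure_radon)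
  moreover have "density_jones \<mu> x \<le> ennreal \<epsilon>" if "x \<in> spt \<mu>" for x
    using density_jones_\<mu>_le[OF that] ennreal_leI[OF jones] by (rule order_trans)
  moreover have "outer_measure_of \<mu> \<Gamma> \<le> ennreal \<epsilon>" if "hausdorff1 \<Gamma> \<le> 1" for \<Gamma>
    using outer_measure_\<mu>_le[OF that] ennreal_leI[OF outer] by (rule order_trans)
  ultimately show ?thesis
    using prob_space_\<mu> by blast
qed

end
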